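(* Every computably approximable real in $(0,1)$ is strongly c.a. $0$-speedable.
   Context: Conventions: "real" means a real number in the open interval $(0,1)$. An approximation of a real $\alpha$ is a sequence $\{a_s\}_{s\in\omega}$ of rational numbers in $[0,1]$ converging to $\alpha$. It is computable if $a_s$ can be computed from $s$. A real is computably approximable (c.a.) if it has a computable approximation. A computable approximation $\{a_s\}_{s\in\omega}$ of a real $\alpha$ is $0$-speedable via the function $s\mapsto s+1$ if either $\alpha$ is rational, or $\alpha$ is irrational and $$\liminf_{s\to\infty}\left|\frac{\alpha-a_{s+1}}{\alpha-a_s}\right|\le 0 .$$ A real is strongly c.a. $0$-speedable if it has a computable approximation that is $0$-speedable via the function $s\mapsto s+1$. *)

theory Defs
  imports "HOL-Analysis.Analysis"
begin

text \<open>Kleene's partial recursive functions. A program is applied to a list of arguments;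
  \<open>Zero\<close>, \<open>Succ\<close> and \<open>Proj\<close> ignore surplus arguments, so that no separate
  arity bookkeeping is needed. Partiality is the absence of a value in the relation
  \<open>computes\<close>.\<close>

datatype recf =
    Zero
  | Succ
  | Proj nat
  | Comp recf "recf list"
  | PrimRec recf recf
  | Mu recf

inductive computes :: "recf \<Rightarrow> nat list \<Rightarrow> nat \<Rightarrow> bool" where
  zero: "computes Zero xs 0"
| succ: "computes Succ (x # xs) (Suc x)"
| proj: "i < length xs \<Longrightarrow> computes (Proj i) xs (xs ! i)"
| comp: "list_all2 (\<lambda>g y. computes g xs y) gs ys \<Longrightarrow> computes f ys z
    \<Longrightarrow> computes (Comp f gs) xs z"
| prim_rec_0: "computes f xs y \<Longrightarrow> computes (PrimRec f g) (0 # xs) y"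
| prim_rec_Suc: "computes (PrimRec f g) (n # xs) y \<Longrightarrow> computes g (n # y # xs) z
    \<Longrightarrow> computes (PrimRec f g) (Suc n # xs) z"
| mu: "computes f (n # xs) 0 \<Longrightarrow> (\<And>m. m < n \<Longrightarrow> \<exists>y>0. computes f (m # xs) y)
    \<Longrightarrow> computes (Mu f) xs n"
monos list_all2_mono

inductive_cases computes_ZeroE: "computes Zero xs y"
inductive_cases computes_SuccE: "computes Succ xs y"
inductive_cases computes_ProjE: "computes (Proj i) xs y"
inductive_cases computes_CompE: "computes (Comp f gs) xs y"
inductive_cases computes_PrimRec_0E: "computes (PrimRec f g) (0 # xs) y"
inductive_cases computes_PrimRec_SucE: "computes (PrimRec f g) (Suc n # xs) y"
inductive_cases computes_MuE: "computes (Mu f) xs y"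

lemma computes_deterministic: "computes p xs y \<Longrightarrow> computes p xs z \<Longrightarrow> y = z"
proof (induction arbitrary: z rule: computes.induct)
  case (zero xs)
  then show ?case by (auto elim: computes_ZeroE)
next
  case (succ x xs)
  then show ?case by (auto elim: computes_SuccE)
next
  case (proj i xs)
  then show ?case by (auto elim: computes_ProjE)
next
  case (comp xs gs ys f w)
  from comp.prems obtain ys' where ys': "list_all2 (\<lambda>g y. computes g xs y) gs ys'" "computes f ys' z"
    by (rule computes_CompE)
  have len: "length ys = length gs" "length ys' = length gs"
    using list_all2_lengthD[OF comp.IH(1)] list_all2_lengthD[OF ys'(1)] by simp_all
  have "ys = ys'"
  proof (rule nth_equalityI)
    show "length ys = length ys'"
      using len by simp
  next
    fix i
    assume "i < length ys"
    then have i: "i < length gs" by (simp only: len)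
    have "computes (gs ! i) xs (ys' ! i)"
      by (rule list_all2_nthD[OF ys'(1) i])
    with list_all2_nthD[OF comp.IH(1) i] show "ys ! i = ys' ! i" by blast
  qed
  with comp.IH(2) ys'(2) show ?case by blast
next
  case (prim_rec_0 f xs y g)
  show ?case using prim_rec_0.prems by (rule computes_PrimRec_0E) (use prim_rec_0.IH in blast)
next
  case (prim_rec_Suc f g n xs y w)
  show ?case using prim_rec_Suc.prems by (rule computes_PrimRec_SucE) (use prim_rec_Suc.IH in blast)
next
  case (mu f n xs)
  from mu.prems obtain z0: "computes f (z # xs) 0"
    and zpos: "\<And>m. m < z \<Longrightarrow> \<exists>y>0. computes f (m # xs) y"
    by (rule computes_MuE) blast
  have "\<not> z < n" using mu.IH(2) z0 by fastforce
  moreover have "\<not> n < z" using mu.IH(1) zpos by blast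
  ultimately show ?case by simp
qed

definition computable :: "(nat \<Rightarrow> nat) \<Rightarrow> bool" where
  "computable f \<longleftrightarrow> (\<exists>p. \<forall>n. computes p [n] (f n))"

definition computable_rat_seq :: "(nat \<Rightarrow> rat) \<Rightarrow> bool" where
  "computable_rat_seq a \<longleftrightarrow>
    (\<exists>sg num den. computable sg \<and> computable num \<and> computable den \<and>
      (\<forall>s. den s \<noteq> 0 \<and> a s = (- 1) ^ sg s * (of_nat (num s) / of_nat (den s))))"

definition approximation :: "(nat \<Rightarrow> rat) \<Rightarrow> real \<Rightarrow> bool" where
  "approximation a \<alpha> \<longleftrightarrow>
    (\<forall>s. 0 \<le> a s \<and> a s \<le> 1) \<and> (\<lambda>s. real_of_rat (a s)) \<longlonglongrightarrow> \<alpha>"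

definition computable_approximation :: "(nat \<Rightarrow> rat) \<Rightarrow> real \<Rightarrow> bool" where
  "computable_approximation a \<alpha> \<longleftrightarrow> approximation a \<alpha> \<and> computable_rat_seq a"

definition computably_approximable :: "real \<Rightarrow> bool" where
  "computably_approximable \<alpha> \<longleftrightarrow> (\<exists>a. computable_approximation a \<alpha>)"

text \<open>For irrational \<open>\<alpha>\<close> the denominators below never vanish. The limit inferior is
  taken in the extended reals, so it exists even for unbounded quotients.\<close>

definition zero_speedable_via_Suc :: "(nat \<Rightarrow> rat) \<Rightarrow> real \<Rightarrow> bool" where
  "zero_speedable_via_Suc a \<alpha> \<longleftrightarrow>
    \<alpha> \<in> \<rat> \<or>
    (\<alpha> \<notin> \<rat> \<and>
     liminf (\<lambda>s. ereal \<bar>(\<alpha> - real_of_rat (a (s + 1))) / (\<alpha> - real_of_rat (a s))\<bar>) \<le> 0)"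

definition strongly_ca_zero_speedable :: "real \<Rightarrow> bool" where
  "strongly_ca_zero_speedable \<alpha> \<longleftrightarrow>
    (\<exists>a. computable_approximation a \<alpha> \<and> zero_speedable_via_Suc a \<alpha>)"

end

theory Submission
  imports Defs
begin

text \<open>Write \<open>\<lfloor>n\<^sup>2 a\<^sub>t\<rfloor>\<close> for the position of \<open>a\<^sub>t\<close> on the grid of mesh \<open>1/n\<^sup>2\<close>, and let
  \<open>n\<^sub>t\<close> be the first \<open>n\<close> (capped at \<open>t + 1\<close>) for which this position changes from \<open>t\<close> to \<open>t + 1\<close>.
  As \<open>\<alpha>\<close> is irrational, every grid position stabilises, so \<open>n\<^sub>t \<longlongrightarrow> \<infinity>\<close>. Hence there are infinitely many
  true stages \<open>t\<close>, at which \<open>n\<^sub>u > n\<^sub>t\<close> for all \<open>u > t\<close>; there the position of \<open>a\<^sub>t\<^sub>+\<^sub>1\<close> with respect to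
  \<open>n\<^sub>t\<close> is final, so that \<open>\<bar>\<alpha> - a\<^sub>t\<^sub>+\<^sub>1\<bar> \<le> 1/n\<^sub>t\<^sup>2\<close>. Precede each \<open>a\<^sub>t\<^sub>+\<^sub>1\<close> by \<open>a\<^sub>t\<^sub>+\<^sub>1(1 - 1/n\<^sub>t)\<close>. This
  still converges to \<open>\<alpha>\<close>, but at true stages the new term has distance of order \<open>1/n\<^sub>t\<close> from \<open>\<alpha>\<close>,
  which makes the quotients at these stages tend to 0.\<close>

section \<open>Recursive functions\<close>

text \<open>Fixing values only on lists of length \<open>n\<close> gives an arity to the arity-free
  programs, so that closure rules can be chained by \<open>intro\<close>.\<close>

definition recursive :: "nat \<Rightarrow> (nat list \<Rightarrow> nat) \<Rightarrow> bool" where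
  "recursive n f \<longleftrightarrow> (\<exists>p. \<forall>xs. length xs = n \<longrightarrow> computes p xs (f xs))"

lemma recursive_cong:
  assumes "recursive n f" and "\<And>xs. length xs = n \<Longrightarrow> f xs = g xs"
  shows "recursive n g"
  using assms unfolding recursive_def by metis

lemma computable_iff_recursive: "computable f \<longleftrightarrow> recursive 1 (\<lambda>xs. f (xs ! 0))"
proof -
  have "(\<forall>xs. length xs = 1 \<longrightarrow> computes p xs (f (xs ! 0))) \<longleftrightarrow> (\<forall>n. computes p [n] (f n))" for p
    by (auto simp: length_Suc_conv)
  then show ?thesis
    by (simp add: computable_def recursive_def)
qed

lemma recursive_proj: "i < n \<Longrightarrow> recursive n (\<lambda>xs. xs ! i)"
  unfolding recursive_def by (auto intro: computes.proj)

lemma recursive_comp: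
  assumes f: "recursive (length gs) f" and gs: "\<And>g. g \<in> set gs \<Longrightarrow> recursive n g"
  shows "recursive n (\<lambda>xs. f (map (\<lambda>g. g xs) gs))"
proof -
  from f obtain p where p: "\<And>xs. length xs = length gs \<Longrightarrow> computes p xs (f xs)"
    unfolding recursive_def by blast
  have "\<forall>g\<in>set gs. \<exists>q. \<forall>xs. length xs = n \<longrightarrow> computes q xs (g xs)"
    using gs unfolding recursive_def by blast
  then obtain Q where Q: "\<And>g xs. g \<in> set gs \<Longrightarrow> length xs = n \<Longrightarrow> computes (Q g) xs (g xs)"
    by metis
  have "computes (Comp p (map Q gs)) xs (f (map (\<lambda>g. g xs) gs))" if "length xs = n" for xs
    by (rule computes.comp[where ys = "map (\<lambda>g. g xs) gs"])
      (use that in \<open>auto simp: list_all2_conv_all_nth intro!: Q p\<close>)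
  then show ?thesis
    unfolding recursive_def by blast
qed

lemma recursive_comp1:
  assumes "computable h" and "recursive n f"
  shows "recursive n (\<lambda>xs. h (f xs))"
  using recursive_comp[of "[f]" "\<lambda>xs. h (xs ! 0)" n] assms
  by (simp add: computable_iff_recursive)

lemma recursive_comp2:
  assumes "recursive 2 (\<lambda>xs. h (xs ! 0) (xs ! 1))" and "recursive n f" and "recursive n g"
  shows "recursive n (\<lambda>xs. h (f xs) (g xs))"
  using recursive_comp[of "[f, g]" "\<lambda>xs. h (xs ! 0) (xs ! 1)" n] assms
  by (auto simp: numeral_2_eq_2)

lemma computable_Suc: "computable Suc"
  unfolding computable_def by (auto intro: computes.succ)

lemma recursive_const: "recursive n (\<lambda>_. c)"
proof (induction c)
  case 0
  then show ?case
    unfolding recursive_def by (auto intro: computes.zero)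
next
  case (Suc c)
  show ?case
    by (rule recursive_comp1[OF computable_Suc Suc])
qed

lemma recursive_rec_nat:
  assumes f: "recursive n f" and g: "recursive (Suc (Suc n)) g"
  shows "recursive (Suc n) (\<lambda>xs. rec_nat (f (tl xs)) (\<lambda>m y. g (m # y # tl xs)) (hd xs))"
proof -
  from f g obtain p q where p: "\<And>xs. length xs = n \<Longrightarrow> computes p xs (f xs)"
    and q: "\<And>xs. length xs = Suc (Suc n) \<Longrightarrow> computes q xs (g xs)"
    unfolding recursive_def by blast
  have "computes (PrimRec p q) (m # xs) (rec_nat (f xs) (\<lambda>m y. g (m # y # xs)) m)"
    if "length xs = n" for m xs
  proof (induction m)
    case 0
    then show ?case using that by (auto intro: computes.prim_rec_0 p)
  next
    case (Suc m)
    then show ?case using q[of "m # rec_nat (f xs) (\<lambda>m y. g (m # y # xs)) m # xs"] that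
      by (auto intro: computes.prim_rec_Suc)
  qed
  then show ?thesis
    unfolding recursive_def by (intro exI[of _ "PrimRec p q"]) (auto simp: length_Suc_conv)
qed

text \<open>Since \<open>f\<close> is total, every argument below the least zero has a positive
  value, which is what \<open>Mu\<close> demands.\<close>

lemma recursive_Least:
  assumes f: "recursive (Suc n) f" and ex: "\<And>xs. length xs = n \<Longrightarrow> \<exists>k. f (k # xs) = 0"
  shows "recursive n (\<lambda>xs. LEAST k. f (k # xs) = 0)"
proof -
  from f obtain p where p: "\<And>xs. length xs = Suc n \<Longrightarrow> computes p xs (f xs)"
    unfolding recursive_def by blast
  have "computes (Mu p) xs (LEAST k. f (k # xs) = 0)" if xs: "length xs = n" for xs
  proof (rule computes.mu)
    show "computes p ((LEAST k. f (k # xs) = 0) # xs) 0"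
      using p[of "(LEAST k. f (k # xs) = 0) # xs"] LeastI_ex[OF ex[OF xs]] xs by simp
    show "\<exists>y>0. computes p (m # xs) y" if "m < (LEAST k. f (k # xs) = 0)" for m
      using p[of "m # xs"] not_less_Least[OF that] xs by auto
  qed
  then show ?thesis
    unfolding recursive_def by blast
qed

lemma recursive_rec_nat2:
  assumes "computable f" and "recursive 3 (\<lambda>xs. g (xs ! 0) (xs ! 1) (xs ! 2))"
  shows "recursive 2 (\<lambda>xs. rec_nat (f (xs ! 1)) (\<lambda>m y. g m y (xs ! 1)) (xs ! 0))"
proof -
  have "recursive (Suc 1) (\<lambda>xs. rec_nat (f (tl xs ! 0))
      (\<lambda>m y. g ((m # y # tl xs) ! 0) ((m # y # tl xs) ! 1) ((m # y # tl xs) ! 2)) (hd xs))"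
    using assms by (intro recursive_rec_nat) (simp_all add: computable_iff_recursive numeral_3_eq_3)
  then show ?thesis
    unfolding Suc_1 by (rule recursive_cong) (auto simp: length_Suc_conv numeral_2_eq_2)
qed

section \<open>Arithmetic of natural numbers\<close>

lemma computable_id: "computable (\<lambda>x. x)"
  by (simp add: computable_iff_recursive recursive_proj)

lemma recursive_add:
  assumes "recursive n f" and "recursive n g"
  shows "recursive n (\<lambda>xs. f xs + g xs)"
proof -
  have eq: "rec_nat y (\<lambda>_. Suc) x = x + y" for x y :: nat
    by (induction x) auto
  have "recursive 2 (\<lambda>xs. rec_nat (xs ! 1) (\<lambda>m y. Suc y) (xs ! 0))"
    by (intro recursive_rec_nat2 computable_id recursive_comp1[OF computable_Suc] recursive_proj) simp
  then show ?thesis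
    using recursive_comp2[where h = "(+)", OF _ assms] by (simp add: eq)
qed

lemma recursive_mult:
  assumes "recursive n f" and "recursive n g"
  shows "recursive n (\<lambda>xs. f xs * g xs)"
proof -
  have eq: "rec_nat 0 (\<lambda>_ z. z + y) x = x * y" for x y :: nat
    by (induction x) auto
  have "recursive 2 (\<lambda>xs. rec_nat 0 (\<lambda>m y. y + xs ! 1) (xs ! 0))"
    by (intro recursive_rec_nat2[where f = "\<lambda>_. 0"] recursive_add recursive_proj)
      (simp_all add: computable_iff_recursive recursive_const)
  then show ?thesis
    using recursive_comp2[where h = "(*)", OF _ assms] by (simp add: eq)
qed

lemma computable_pred: "computable (\<lambda>x. x - 1)"
proof -
  have eq: "rec_nat 0 (\<lambda>m _. m) x = x - 1" for x :: nat
    by (cases x) auto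
  have "recursive 2 (\<lambda>xs. rec_nat 0 (\<lambda>m _. m) (xs ! 0))"
    by (intro recursive_rec_nat2[where f = "\<lambda>_. 0"] recursive_proj)
      (simp_all add: computable_iff_recursive recursive_const)
  then have "recursive 2 (\<lambda>xs. xs ! 0 - 1)"
    by (simp add: eq)
  \<comment> \<open>The recursion scheme carries a parameter; a projection fills this dummy
    argument.\<close>
  from recursive_comp2[where h = "\<lambda>x _. x - 1", OF this recursive_proj recursive_proj]
  show ?thesis
    by (simp add: computable_iff_recursive)
qed

lemma recursive_diff:
  assumes "recursive n f" and "recursive n g"
  shows "recursive n (\<lambda>xs. f xs - g xs)"
proof -
  have eq: "rec_nat y (\<lambda>_ z. z - Suc 0) x = y - x" for x y :: nat
    by (induction x) auto
  have "recursive 2 (\<lambda>xs. rec_nat (xs ! 1) (\<lambda>m y. y - 1) (xs ! 0))"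
    by (intro recursive_rec_nat2 computable_id recursive_comp1[OF computable_pred] recursive_proj) simp
  then show ?thesis
    \<comment> \<open>The recursion runs over the subtrahend, hence the swapped arguments.\<close>
    using recursive_comp2[where h = "\<lambda>x y. y - x", OF _ assms(2,1)] by (simp add: eq)
qed

text \<open>The factor \<open>y\<close> makes the search succeed at once when \<open>y = 0\<close>, in accordance with
  \<open>x div 0 = 0\<close>.\<close>

lemma div_eq_Least: "x div y = (LEAST q. (x + 1 - y * (q + 1)) * y = 0)" for x y :: nat
proof (rule sym, rule Least_equality)
  \<comment> \<open>For \<open>y > 0\<close> truncated subtraction makes the condition on
    \<open>q\<close> say \<open>x < y * (q + 1)\<close>.\<close>
  show "(x + 1 - y * (x div y + 1)) * y = 0"
    using dividend_less_times_div[of y x] by (cases "y = 0") (auto simp: Suc_le_eq)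
next
  fix q
  assume "(x + 1 - y * (q + 1)) * y = 0"
  then show "x div y \<le> q"
    by (cases "y = 0") (auto simp: less_Suc_eq_le[symmetric] less_mult_imp_div_less Suc_le_eq mult.commute)
qed

lemma recursive_div:
  assumes "recursive n f" and "recursive n g"
  shows "recursive n (\<lambda>xs. f xs div g xs)"
proof -
  have "recursive 2 (\<lambda>xs. LEAST q. ((q # xs) ! 1 + 1 - (q # xs) ! 2 * ((q # xs) ! 0 + 1)) * (q # xs) ! 2 = 0)"
  proof (rule recursive_Least)
    show "recursive (Suc 2) (\<lambda>xs. (xs ! 1 + 1 - xs ! 2 * (xs ! 0 + 1)) * xs ! 2)"
      by (intro recursive_mult recursive_diff recursive_add recursive_proj recursive_const) simp_all
  next
    fix xs :: "nat list"
    \<comment> \<open>The dividend itself is a witness: a quotient never exceeds it.\<close>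
    have "(xs ! 0 + 1 - xs ! 1 * (xs ! 0 + 1)) * xs ! 1 = 0"
      by (cases "xs ! 1") auto
    then show "\<exists>q. ((q # xs) ! 1 + 1 - (q # xs) ! 2 * ((q # xs) ! 0 + 1)) * (q # xs) ! 2 = 0"
      by (intro exI[of _ "xs ! 0"]) simp
  qed
  then show ?thesis
    using recursive_comp2[where h = "(div)", OF _ assms] by (simp add: div_eq_Least)
qed

section \<open>The first grid that changes\<close>

text \<open>With \<open>a s = u s / v s\<close>, this is \<open>n\<^sub>t - 1\<close> in the sketch above; the shift keeps \<open>n\<^sub>t\<close> positive.\<close>

definition first_change :: "(nat \<Rightarrow> nat) \<Rightarrow> (nat \<Rightarrow> nat) \<Rightarrow> nat \<Rightarrow> nat" where
  "first_change u v t =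
    (LEAST k. t \<le> k \<or> (k + 1)\<^sup>2 * u (t + 1) div v (t + 1) \<noteq> (k + 1)\<^sup>2 * u t div v t)"

lemma computable_first_change:
  assumes "computable u" and "computable v"
  shows "computable (first_change u v)"
proof -
  define q where "q k t = (k + 1)\<^sup>2 * u t div v t" for k t
  have rec_q: "recursive n (\<lambda>xs. q (f xs) (g xs))" if "recursive n f" "recursive n g" for n f g
    unfolding q_def power2_eq_square
    by (intro recursive_div recursive_mult recursive_add recursive_const
        recursive_comp1[OF assms(1)] recursive_comp1[OF assms(2)] that)
  \<comment> \<open>The product encodes the disjunction. The sum of both truncated differences is
    the distance of the two positions, so the second factor vanishes iff they differ.\<close>
  let ?D = "\<lambda>k t. (t - k) * (1 - ((q k (t + 1) - q k t) + (q k t - q k (t + 1))))"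
  have "recursive 1 (\<lambda>xs. LEAST k. ?D ((k # xs) ! 0) ((k # xs) ! 1) = 0)"
  proof (rule recursive_Least)
    show "recursive (Suc 1) (\<lambda>xs. ?D (xs ! 0) (xs ! 1))"
      by (intro recursive_mult recursive_diff recursive_add rec_q recursive_proj recursive_const) simp_all
  next
    fix xs :: "nat list"
    show "\<exists>k. ?D ((k # xs) ! 0) ((k # xs) ! 1) = 0"
      \<comment> \<open>The cap \<open>k = t\<close> ends the search even if no grid sees a
        change.\<close>
      by (intro exI[of _ "xs ! 0"]) simp
  qed
  moreover have "?D k t = 0 \<longleftrightarrow> t \<le> k \<or> q k (t + 1) \<noteq> q k t" for k t
    by auto
  ultimately show ?thesis
    by (simp add: computable_iff_recursive first_change_def q_def[abs_def])
qed

lemma first_change_agree: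
  "k < first_change u v t \<Longrightarrow> (k + 1)\<^sup>2 * u (t + 1) div v (t + 1) = (k + 1)\<^sup>2 * u t div v t"
  unfolding first_change_def by (drule not_less_Least) blast

lemma first_change_ge:
  assumes "K \<le> t"
    and "\<And>k. k < K \<Longrightarrow> (k + 1)\<^sup>2 * u (t + 1) div v (t + 1) = (k + 1)\<^sup>2 * u t div v t"
  shows "K \<le> first_change u v t"
  unfolding first_change_def
proof (rule LeastI2_ex)
  show "\<exists>k. t \<le> k \<or> (k + 1)\<^sup>2 * u (t + 1) div v (t + 1) \<noteq> (k + 1)\<^sup>2 * u t div v t"
    by blast
qed (use assms in \<open>meson le_trans not_le\<close>)

section \<open>Stabilisation of grid positions and true stages\<close>

lemma floor_real_of_nat_div: "\<lfloor>real c * (real x / real y)\<rfloor> = int (c * x div y)"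
  using floor_divide_of_nat_eq[of "c * x" y, where ?'a = real] by simp

text \<open>A positive integer multiple of an irrational is not an integer, and the floor is locally
  constant away from the integers.\<close>

lemma eventually_floor_mult_eq:
  fixes \<alpha> :: real
  assumes "\<alpha> \<notin> \<rat>" and "X \<longlonglongrightarrow> \<alpha>"
  shows "\<forall>\<^sub>F t in sequentially. \<lfloor>real (Suc n) * X t\<rfloor> = \<lfloor>real (Suc n) * \<alpha>\<rfloor>"
proof -
  have "real (Suc n) * \<alpha> \<notin> \<int>"
  proof
    assume "real (Suc n) * \<alpha> \<in> \<int>"
    then have "real (Suc n) * \<alpha> / real (Suc n) \<in> \<rat>"
      using Ints_subset_Rats by (intro Rats_divide) auto
    with assms(1) show False by simp
  qed
  then show ?thesis
    by (intro eventually_floor_eq tendsto_intros assms(2))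
qed

text \<open>Only finitely many grids lie below a given \<open>K\<close>, and each position is
  eventually that of the limit, so eventually none of them changes.\<close>

lemma filterlim_first_change:
  assumes "\<alpha> \<notin> \<rat>" and lim: "(\<lambda>t. real (u t) / real (v t)) \<longlonglongrightarrow> \<alpha>"
  shows "filterlim (first_change u v) at_top sequentially"
  unfolding filterlim_at_top
proof
  fix K
  have "\<forall>\<^sub>F t in sequentially. (k + 1)\<^sup>2 * u (t + 1) div v (t + 1) = (k + 1)\<^sup>2 * u t div v t" for k
  proof -
    let ?E = "\<lambda>t. \<lfloor>real ((k + 1)\<^sup>2) * (real (u t) / real (v t))\<rfloor> = \<lfloor>real ((k + 1)\<^sup>2) * \<alpha>\<rfloor>"
    obtain n where n: "(k + 1)\<^sup>2 = Suc n"
      by (metis add_is_0 not0_implies_Suc one_neq_zero zero_eq_power2)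
    have E: "\<forall>\<^sub>F t in sequentially. ?E t"
      unfolding n by (rule eventually_floor_mult_eq[OF assms])
    moreover from E have "\<forall>\<^sub>F t in sequentially. ?E (t + 1)"
      using eventually_sequentially_Suc[of ?E] by simp
    ultimately show ?thesis
      by eventually_elim (metis floor_real_of_nat_div of_nat_eq_iff)
  qed
  then have "\<forall>\<^sub>F t in sequentially. \<forall>k\<in>{..<K}.
      (k + 1)\<^sup>2 * u (t + 1) div v (t + 1) = (k + 1)\<^sup>2 * u t div v t"
    by (intro eventually_ball_finite) auto
  with eventually_ge_at_top[of K] show "\<forall>\<^sub>F t in sequentially. K \<le> first_change u v t"
    by eventually_elim (auto intro!: first_change_ge)
qed

text \<open>Take the last stage from \<open>N\<close> on whose value is at most \<open>k N\<close>.
  It exists because \<open>k\<close> tends to infinity, and all later values exceed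
  \<open>k N\<close>.\<close>

lemma ex_strict_tail_min:
  fixes k :: "nat \<Rightarrow> nat"
  assumes "filterlim k at_top sequentially"
  shows "\<exists>t\<ge>N. \<forall>t'>t. k t < k t'"
proof -
  let ?S = "{t. N \<le> t \<and> k t \<le> k N}"
  obtain M where M: "\<And>t. M \<le> t \<Longrightarrow> Suc (k N) \<le> k t"
    using assms unfolding filterlim_at_top eventually_sequentially by meson
  have "t \<le> M" if "t \<in> ?S" for t
    using M[of t] that by (cases "M \<le> t") auto
  then have "?S \<subseteq> {..M}"
    by blast
  then have fin: "finite ?S"
    using finite_subset by blast
  have "Max ?S \<in> ?S"
    using fin by (intro Max_in) auto
  moreover have "k N < k t'" if "Max ?S < t'" for t'
  proof (rule ccontr)
    assume "\<not> k N < k t'"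
    with that \<open>Max ?S \<in> ?S\<close> have "t' \<in> ?S" by auto
    with fin that show False by (meson Max_ge not_le)
  qed
  ultimately show ?thesis
    by (intro exI[of _ "Max ?S"]) fastforce
qed

text \<open>After a true stage all terms stay in one grid cell of width \<open>1 / c\<close>; the
  resulting non-strict bound passes to the limit.\<close>

lemma true_stage_bound:
  fixes \<alpha> :: real
  assumes lim: "(\<lambda>t. real (u t) / real (v t)) \<longlonglongrightarrow> \<alpha>"
    and true_stage: "\<And>t'. t < t' \<Longrightarrow> first_change u v t < first_change u v t'"
  shows "\<bar>\<alpha> - real (u (t + 1)) / real (v (t + 1))\<bar> \<le> 1 / (real (first_change u v t) + 1)\<^sup>2"
proof -
  define c where "c = (first_change u v t + 1)\<^sup>2"
  have c: "0 < c" unfolding c_def by simp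
  let ?a = "\<lambda>s. real (u s) / real (v s)"
  \<comment> \<open>Agreement starts only at \<open>t + 1\<close>: the step from \<open>t\<close> to
    \<open>t + 1\<close> may change this very grid position.\<close>
  have agree: "c * u s div v s = c * u (t + 1) div v (t + 1)" if "t + 1 \<le> s" for s
    using that
  proof (induction s rule: dec_induct)
    case (step s)
    then show ?case
      using first_change_agree[OF true_stage[of s]] by (simp add: c_def)
  qed simp
  have "\<bar>?a s - ?a (t + 1)\<bar> \<le> 1 / real c" if "t + 1 \<le> s" for s
  proof -
    have "\<lfloor>real c * ?a s\<rfloor> = \<lfloor>real c * ?a (t + 1)\<rfloor>"
      by (simp only: floor_real_of_nat_div agree[OF that])
    then have "\<bar>real c * ?a s - real c * ?a (t + 1)\<bar> \<le> 1"
      by linarith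
    then have "real c * \<bar>?a s - ?a (t + 1)\<bar> \<le> 1"
      by (simp add: right_diff_distrib[symmetric] abs_mult del: times_divide_eq_right)
    then show ?thesis
      using c by (simp add: pos_le_divide_eq mult.commute)
  qed
  then have "\<bar>\<alpha> - ?a (t + 1)\<bar> \<le> 1 / real c"
    by (intro tendsto_upperbound[OF tendsto_rabs[OF tendsto_diff[OF lim tendsto_const]]])
      (auto simp: eventually_sequentially)
  then show ?thesis
    by (simp add: c_def add.commute)
qed

text \<open>The numerator is at most \<open>1 / n\<^sup>2\<close>, while the denominator is at least
  \<open>y / n - 1 / n\<^sup>2\<close>, so the quotient is at most \<open>1 / (y * n - 1)\<close>.
  With \<open>y\<close> at least \<open>\<alpha> / 2\<close>, the threshold on \<open>n\<close>
  gives \<open>y * n \<ge> 1 + 1 / \<epsilon>\<close>.\<close>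

lemma quotient_le:
  fixes \<alpha> y n \<epsilon> :: real
  assumes \<alpha>: "0 < \<alpha>" and \<epsilon>: "0 < \<epsilon>" and n: "2 * (1 + \<epsilon>) / (\<epsilon> * \<alpha>) \<le> n"
    and y: "\<alpha> / 2 \<le> y" and dist: "\<bar>\<alpha> - y\<bar> \<le> 1 / n\<^sup>2"
  shows "\<bar>(\<alpha> - y) / (\<alpha> - y * ((n - 1) / n))\<bar> \<le> \<epsilon>"
proof -
  have "0 < 2 * (1 + \<epsilon>) / (\<epsilon> * \<alpha>)" using \<alpha> \<epsilon> by simp
  with n have n0: "0 < n" by linarith
  define x where "x = y * ((n - 1) / n)"
  have "\<alpha> / 2 * n \<le> y * n" using y n0 by simp
  moreover have "1 + \<epsilon> \<le> \<epsilon> * (\<alpha> / 2 * n)"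
    using n \<alpha> \<epsilon> by (simp add: field_simps)
  ultimately have "1 + \<epsilon> \<le> \<epsilon> * (y * n)"
    using \<epsilon> by (meson mult_left_mono less_imp_le order_trans)
  then have "1 \<le> \<epsilon> * (y * n - 1)" by (simp add: algebra_simps)
  then have "1 / n\<^sup>2 \<le> \<epsilon> * (y * n - 1) / n\<^sup>2"
    by (intro divide_right_mono) auto
  also have "\<dots> = \<epsilon> * (y / n - 1 / n\<^sup>2)"
    using n0 by (simp add: field_simps power2_eq_square)
  also have "y / n = y - x"
    using n0 by (simp add: x_def field_simps)
  finally have *: "1 / n\<^sup>2 \<le> \<epsilon> * (y - x - 1 / n\<^sup>2)" .
  \<comment> \<open>Triangle inequality: \<open>y - x\<close> is at most the sum of the distances of
    \<open>\<alpha>\<close> from \<open>x\<close> and from \<open>y\<close>.\<close>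
  also have "\<dots> \<le> \<epsilon> * \<bar>\<alpha> - x\<bar>"
    using dist \<epsilon> by (intro mult_left_mono) auto
  finally have "\<bar>\<alpha> - y\<bar> \<le> \<epsilon> * \<bar>\<alpha> - x\<bar>"
    using dist by linarith
  \<comment> \<open>For \<open>\<alpha> = x\<close> the quotient is 0, as division by zero yields
    0.\<close>
  then show ?thesis
    unfolding x_def[symmetric] using \<epsilon> by (cases "\<alpha> = x") (simp_all add: pos_divide_le_eq)
qed

section \<open>The interleaved approximation\<close>

text \<open>Absolute values remove the sign factor, a power of -1, without changing a nonnegative
  term.\<close>

lemma computable_rat_seq_nonneg:
  assumes "computable_rat_seq a" and nonneg: "\<And>s. 0 \<le> a s"
  obtains u v where "computable u" "computable v" "\<And>s. v s \<noteq> 0"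
    "\<And>s. a s = of_nat (u s) / of_nat (v s)"
proof -
  from assms(1) obtain sg u v where uv: "computable u" "computable v" "\<And>s. v s \<noteq> 0"
    and a: "\<And>s. a s = (- 1) ^ sg s * (of_nat (u s) / of_nat (v s))"
    unfolding computable_rat_seq_def by blast
  have "a s = \<bar>a s\<bar>" for s
    using nonneg[of s] by simp
  also have "\<bar>a s\<bar> = of_nat (u s) / of_nat (v s)" for s
    by (simp add: a abs_mult power_abs)
  finally show thesis
    by (intro that[OF uv])
qed

lemma computable_rat_seq_of_nat_divide:
  assumes "computable u" and "computable v" and "\<And>s. v s \<noteq> 0"
  shows "computable_rat_seq (\<lambda>s. of_nat (u s) / of_nat (v s))"
  unfolding computable_rat_seq_def
proof (intro exI conjI allI)
  show "computable (\<lambda>_. 0)"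
    by (simp add: computable_iff_recursive recursive_const)
qed (use assms in auto)

lemma ex_zero_speedable_approximation:
  fixes \<alpha> :: real
  assumes \<alpha>: "0 < \<alpha>" "\<alpha> \<notin> \<rat>" and "computable_approximation a \<alpha>"
  shows "\<exists>b. computable_approximation b \<alpha> \<and> zero_speedable_via_Suc b \<alpha>"
proof -
  from assms(3) have a: "\<And>s. 0 \<le> a s" "\<And>s. a s \<le> 1" "(\<lambda>s. real_of_rat (a s)) \<longlonglongrightarrow> \<alpha>"
    "computable_rat_seq a"
    unfolding computable_approximation_def approximation_def by auto
  from computable_rat_seq_nonneg[OF a(4,1)] obtain u v where uv: "computable u" "computable v"
    and v: "\<And>s. v s \<noteq> 0" and a_eq: "\<And>s. a s = of_nat (u s) / of_nat (v s)" by metis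
  have real_a: "real_of_rat (a s) = real (u s) / real (v s)" for s
    by (simp add: a_eq of_rat_divide)
  let ?k = "first_change u v"
  note lim = a(3)[unfolded real_a]
  have k_lim: "filterlim ?k at_top sequentially"
    by (rule filterlim_first_change[OF \<alpha>(2) lim])

  \<comment> \<open>\<open>b (2 * t + 1) = a (t + 1)\<close> and \<open>b (2 * t) = a (t + 1) * (1 - 1 / n\<^sub>t)\<close> with \<open>n\<^sub>t = ?k t + 1\<close>\<close>
  define b :: "nat \<Rightarrow> rat" where "b s = of_nat (u (s div 2 + 1) * (?k (s div 2) + s mod 2))
    / of_nat (v (s div 2 + 1) * (?k (s div 2) + 1))" for s
  have b_rat: "b s = a (s div 2 + 1) * (of_nat (?k (s div 2) + s mod 2) / of_nat (?k (s div 2) + 1))" for s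
    by (simp only: b_def a_eq of_nat_mult times_divide_times_eq)
  have b: "real_of_rat (b s) = real_of_rat (a (s div 2 + 1))
      * (real (?k (s div 2) + s mod 2) / real (?k (s div 2) + 1))" for s
    unfolding b_rat of_rat_mult of_rat_divide of_rat_of_nat_eq by (rule refl)

  have "computable_rat_seq b"
    unfolding b_def[abs_def]
  proof (rule computable_rat_seq_of_nat_divide)
    note rec = recursive_div recursive_mult recursive_add recursive_diff recursive_proj recursive_const
      recursive_comp1[OF uv(1)] recursive_comp1[OF uv(2)] recursive_comp1[OF computable_first_change[OF uv]]
    \<comment> \<open>This reduces the parity to division, multiplication and truncated
      subtraction.\<close>
    have mod2: "s mod 2 = s - s div 2 * 2" for s :: nat
      by (simp add: minus_div_mult_eq_mod)
    show "computable (\<lambda>s. u (s div 2 + 1) * (?k (s div 2) + s mod 2))"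
      unfolding computable_iff_recursive mod2 by (intro rec) simp_all
    show "computable (\<lambda>s. v (s div 2 + 1) * (?k (s div 2) + 1))"
      unfolding computable_iff_recursive by (intro rec) simp_all
  qed (simp add: v)
  moreover have "approximation b \<alpha>"
    unfolding approximation_def
  proof (intro conjI allI)
    fix s :: nat
    show "0 \<le> b s"
      unfolding b_rat using a(1) by (intro mult_nonneg_nonneg divide_nonneg_nonneg) auto
    have "of_nat (?k (s div 2) + s mod 2) \<le> (of_nat (?k (s div 2) + 1) :: rat)"
      by (intro of_nat_mono add_left_mono) linarith
    moreover have "0 < (of_nat (?k (s div 2) + 1) :: rat)"
      unfolding of_nat_0_less_iff by simp
    ultimately have "of_nat (?k (s div 2) + s mod 2) / of_nat (?k (s div 2) + 1) \<le> (1 :: rat)"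
      by (simp only: divide_le_eq_1_pos)
    then show "b s \<le> 1"
      unfolding b_rat using a(1,2) by (intro mult_le_one) auto
  next
    have div2: "filterlim (\<lambda>s::nat. s div 2) sequentially sequentially"
      by (auto simp: filterlim_at_top eventually_sequentially less_eq_div_iff_mult_less_eq)
    have "(\<lambda>s. real_of_rat (a (s div 2 + 1))) \<longlonglongrightarrow> \<alpha>"
      using filterlim_compose[OF LIMSEQ_Suc[OF a(3)] div2] by simp
    moreover have "(\<lambda>s. real (?k (s div 2) + s mod 2) / real (?k (s div 2) + 1)) \<longlonglongrightarrow> 1"
    \<comment> \<open>The factor is 1 at odd \<open>s\<close> and \<open>k / (k + 1)\<close> at even
      \<open>s\<close>, with \<open>k\<close> tending to infinity.\<close>
    proof (rule tendsto_sandwich[OF _ _ _ tendsto_const])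
      have "(\<lambda>n. real n / real (n + 1)) \<longlonglongrightarrow> 1"
        using LIMSEQ_n_over_Suc_n[where ?'a = real] by simp
      from filterlim_compose[OF this filterlim_compose[OF k_lim div2]]
      show "(\<lambda>s. real (?k (s div 2)) / real (?k (s div 2) + 1)) \<longlonglongrightarrow> 1" .
    qed (auto intro!: always_eventually divide_right_mono)
    ultimately show "(\<lambda>s. real_of_rat (b s)) \<longlonglongrightarrow> \<alpha>"
      unfolding b using tendsto_mult by fastforce
  qed
  moreover have "liminf (\<lambda>s. ereal \<bar>(\<alpha> - real_of_rat (b (s + 1))) / (\<alpha> - real_of_rat (b s))\<bar>) \<le> 0"
    (is "liminf ?q \<le> 0")
  \<comment> \<open>A positive limit inferior would keep all late quotients above some
    \<open>\<epsilon> > 0\<close>; a late true stage \<open>t\<close> refutes this at index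
    \<open>2 * t\<close>.\<close>
  proof (rule ccontr)
    assume "\<not> liminf ?q \<le> 0"
    then have "0 < liminf ?q"
      by (rule not_le[THEN iffD1])
    then obtain \<epsilon> where \<epsilon>: "0 < ereal \<epsilon>" "ereal \<epsilon> < liminf ?q"
      using ereal_dense2 by blast
    from less_LiminfD[OF \<epsilon>(2)] obtain N1 where N1: "\<And>s. N1 \<le> s \<Longrightarrow> ereal \<epsilon> < ?q s"
      by (auto simp: eventually_sequentially)
    have "\<forall>\<^sub>F s in sequentially. \<alpha> / 2 < real_of_rat (a s)"
      using order_tendstoD(1)[OF a(3), of "\<alpha> / 2"] \<alpha> by simp
    then obtain N2 where N2: "\<And>s. N2 \<le> s \<Longrightarrow> \<alpha> / 2 < real_of_rat (a s)"
      by (auto simp: eventually_sequentially)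
    \<comment> \<open>This is the threshold of \<open>quotient_le\<close>.\<close>
    obtain N3 where N3: "\<And>t. N3 \<le> t \<Longrightarrow> nat \<lceil>2 * (1 + \<epsilon>) / (\<epsilon> * \<alpha>)\<rceil> \<le> ?k t"
      using k_lim unfolding filterlim_at_top eventually_sequentially by meson
    obtain t where t: "max N1 (max N2 N3) \<le> t" and true_stage: "\<And>t'. t < t' \<Longrightarrow> ?k t < ?k t'"
      using ex_strict_tail_min[OF k_lim] by blast
    let ?y = "real_of_rat (a (t + 1))" and ?n = "real (?k t) + 1"
    have "2 * (1 + \<epsilon>) / (\<epsilon> * \<alpha>) \<le> ?n"
      using N3[of t] t by linarith
    moreover have "\<alpha> / 2 \<le> ?y"
      using N2[of "t + 1"] t by simp
    moreover have "\<bar>\<alpha> - ?y\<bar> \<le> 1 / ?n\<^sup>2"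
      using true_stage_bound[OF lim true_stage] by (simp add: real_a)
    ultimately have "\<bar>(\<alpha> - ?y) / (\<alpha> - ?y * ((?n - 1) / ?n))\<bar> \<le> \<epsilon>"
      using \<alpha> \<epsilon>(1) by (intro quotient_le) auto
    moreover have "real_of_rat (b (2 * t)) = ?y * ((?n - 1) / ?n)"
      by (simp add: b add.commute)
    moreover have "real_of_rat (b (2 * t + 1)) = ?y"
      by (simp add: b)
    ultimately have "?q (2 * t) \<le> ereal \<epsilon>" by simp
    with N1[of "2 * t"] t show False by simp
  qed
  ultimately show ?thesis
    using \<alpha> unfolding computable_approximation_def zero_speedable_via_Suc_def by blast
qed

theorem theorem3p4:
  fixes \<alpha> :: real
  assumes "0 < \<alpha>" and "\<alpha> < 1"
    and "computably_approximable \<alpha>"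
  shows "strongly_ca_zero_speedable \<alpha>"
proof (cases "\<alpha> \<in> \<rat>")
  \<comment> \<open>For rational \<open>\<alpha>\<close> every computable approximation qualifies by
    definition.\<close>
  case True
  with assms(3) show ?thesis
    unfolding strongly_ca_zero_speedable_def computably_approximable_def zero_speedable_via_Suc_def
    by blast
next
  case False
  with assms ex_zero_speedable_approximation show ?thesis
    unfolding strongly_ca_zero_speedable_def computably_approximable_def by blast
qed

end
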